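(* Let $A_0,A_1\in\mathbb{R}^{n_x\times n_x}$. Suppose $\tau^*>0$ and $\tau\in\mathcal{C}^1(\mathbb{R},\mathbb{R}_+)$ with $\dot\tau(t)<1$ for all $t\ge 0$. Let $h\in\mathcal{C}^1([-\tau^*,\infty),[-\tau(0),\infty))$ be a strictly increasing unbounded function with $h(0)=0$ and $$h(\lambda)-\tau(h(\lambda))=h(\lambda-\tau^* )\qquad\text{for all }\lambda\ge 0.$$ (i) For any $\zeta\in\mathcal{C}([-\tau(0),0],\mathbb{R}^{n_x})$, if $x:[-\tau(0),\infty)\to\mathbb{R}^{n_x}$ satisfies $$\dot x(t)=A_0x(t)+A_1x(t-\tau(t))\ \ \forall t\ge 0,\qquad x(t)=\zeta(t)\ \ \forall t\in[-\tau(0),0],\tag{A}$$ then $\bar x(\lambda):=x(h(\lambda))$ (for $\lambda\ge-\tau^*$) and $\bar\zeta(\lambda):=\zeta(h(\lambda))$ (for $\lambda\in[-\tau^*,0]$) satisfy $$\dot{\bar x}(\lambda)=\dot h(\lambda)A_0\bar x(\lambda)+\dot h(\lambda)A_1\bar x(\lambda-\tau^* )\ \ \forall\lambda\ge 0,\qquad \bar x(\lambda)=\bar\zeta(\lambda)\ \ \forall\lambda\in[-\tau^*,0].\tag{B}$$ (ii) Conversely, if $\bar\zeta\in\mathcal{C}([-\tau^*,0],\mathbb{R}^{n_x})$ and $\bar x:[-\tau^*,\infty)\to\mathbb{R}^{n_x}$ satisfies (B), then $x(t):=\bar x(h^{-1}(t))$ (for $t\ge-\tau(0)$) and $\zeta(t):=\bar\zeta(h^{-1}(t))$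 (for $t\in[-\tau(0),0]$) satisfy (A).
   Context: $\mathbb{R}_+$ denotes the positive real numbers. $\mathcal{C}$ and $\mathcal{C}^1$ denote continuous and continuously differentiable functions, respectively. A dot denotes the derivative of a function with respect to its own argument. Solutions of the delay equations are continuous on their whole domain; since the initial functions are only continuous, the derivative of the solution at the initial time $t=0$ (respectively $\lambda=0$) is understood as the right derivative. *)

theory Defs
  imports "HOL-Analysis.Analysis"
begin

text \<open>
  Continuous differentiability on a set that need not be open: derivatives are taken within the
  set, so they are one-sided at the end point of a half-line. The library's
  \<open>C1_differentiable_on\<close> demands two-sided derivatives everywhere, which would
  constrain a function outside a closed interval.
\<close>

definition C1_within :: "(real \<Rightarrow> 'a::real_normed_vector) \<Rightarrow> real set \<Rightarrow> bool" where
  "C1_within f S \<longleftrightarrow>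
    (\<exists>f'. (\<forall>t\<in>S. (f has_vector_derivative f' t) (at t within S)) \<and> continuous_on S f')"

text \<open>
  \<open>x : [-r, \<infinity>) \<rightarrow> \<real>\<^sup>n\<close> is a solution of
  \<open>x'(t) = B0(t) x(t) + B1(t) x(t - \<sigma>(t))\<close> for \<open>t \<ge> 0\<close> with \<open>x = \<phi>\<close> on \<open>[-r, 0]\<close>.
  The derivative within \<open>[0, \<infinity>)\<close> is the right derivative at \<open>0\<close> and the ordinary
  two-sided derivative at every \<open>t > 0\<close>. Values of \<open>x\<close> to the left of \<open>-r\<close>, and of \<open>\<phi>\<close>
  outside \<open>[-r, 0]\<close>, are irrelevant as long as \<open>t - \<sigma>(t) \<ge> -r\<close> for all \<open>t \<ge> 0\<close>.
\<close>

definition dde_solution ::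
  "real \<Rightarrow> (real \<Rightarrow> real) \<Rightarrow> (real \<Rightarrow> real^'n^'n) \<Rightarrow> (real \<Rightarrow> real^'n^'n) \<Rightarrow>
    (real \<Rightarrow> real^'n) \<Rightarrow> (real \<Rightarrow> real^'n) \<Rightarrow> bool" where
  "dde_solution r \<sigma> B0 B1 \<phi> x \<longleftrightarrow>
    continuous_on {-r..} x \<and>
    (\<forall>t\<ge>0. (x has_vector_derivative (B0 t *v x t + B1 t *v x (t - \<sigma> t))) (at t within {0..})) \<and>
    (\<forall>t\<in>{-r..0}. x t = \<phi> t)"

end

theory Submission
  imports Defs
begin

text \<open>
  Part (i) is the chain rule. In part (ii) the derivative of \<open>h\<close> may vanish, so \<open>h\<inverse>\<close> need not
  be differentiable and the chain rule does not apply to \<open>xb \<circ> h\<inverse>\<close>. However, \<open>xb' = h' G\<close> with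
  \<open>G\<close> continuous, so \<open>xb\<close> and \<open>F \<circ> h\<close>, where \<open>F\<close> is a primitive of \<open>G \<circ> h\<inverse>\<close>, have the same
  derivative. Hence \<open>xb \<circ> h\<inverse>\<close> is \<open>F\<close> up to a constant.
\<close>

text \<open>The integral from \<open>a\<close> is a primitive: differentiability at \<open>t\<close>
  is local, so it can be checked on a compact interval reaching past \<open>t\<close>.\<close>

lemma primitive_on_half_line:
  fixes g :: "real \<Rightarrow> 'a::banach"
  assumes "continuous_on {a..} g"
  obtains F where "\<And>t. t \<ge> a \<Longrightarrow> (F has_vector_derivative g t) (at t within {a..})"
proof
  fix t :: real assume t: "t \<ge> a"
  have "((\<lambda>u. integral {a..u} g) has_vector_derivative g t) (at t within {a..t+1})"
    using t by (intro integral_has_vector_derivative continuous_on_subset[OF assms]) auto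
  moreover have "at t within {a..t+1} = at t within {a..}"
    by (rule at_within_nhd[of _ "{..<t+1}"]) auto
  ultimately show "((\<lambda>u. integral {a..u} g) has_vector_derivative g t) (at t within {a..})"
    by simp
qed

text \<open>This replaces the chain rule along \<open>k\<close>, which is only known to be
  continuous. The factor \<open>h'\<close> is never divided out, so its zeros do no harm.\<close>

lemma has_vector_derivative_compose_inverse:
  fixes y G :: "real \<Rightarrow> 'a::banach" and h k :: "real \<Rightarrow> real"
  assumes y: "\<And>l. l \<ge> a \<Longrightarrow> (y has_vector_derivative h' l *\<^sub>R G l) (at l within {a..})"
    and h: "\<And>l. l \<ge> a \<Longrightarrow> (h has_vector_derivative h' l) (at l within {a..})"
    and hom: "homeomorphism {a..} {b..} h k"
    and G: "continuous_on {a..} G"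
    and t: "t \<ge> b"
  shows "((\<lambda>t. y (k t)) has_vector_derivative G (k t)) (at t within {b..})"
proof -
  have kh: "k (h l) = l" if "l \<ge> a" for l
    using hom that by (auto simp: homeomorphism_def)
  have hk: "h (k s) = s" if "s \<ge> b" for s
    using hom that by (auto simp: homeomorphism_def)
  have h_img: "h ` {a..} = {b..}" and k_img: "k ` {b..} = {a..}" and k_cont: "continuous_on {b..} k"
    using hom by (auto simp: homeomorphism_def)
  have "continuous_on {b..} (\<lambda>s. G (k s))"
    by (rule continuous_on_compose2[OF G k_cont]) (simp add: k_img)
  then obtain F where
    F: "\<And>s. s \<ge> b \<Longrightarrow> (F has_vector_derivative G (k s)) (at s within {b..})"
    using primitive_on_half_line by blast
  \<comment> \<open>The comparison is made in the variable \<open>l\<close>, where both terms are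
    differentiable. As \<open>k (h l) = l\<close>, each has derivative
    \<open>h' l *\<^sub>R G l\<close>.\<close>
  have "((\<lambda>l. y l - F (h l)) has_vector_derivative 0) (at l within {a..})" if l: "l \<in> {a..}" for l
  proof -
    have "h l \<ge> b" using h_img l by auto
    then have "(F \<circ> h has_vector_derivative h' l *\<^sub>R G (k (h l))) (at l within {a..})"
      using l by (intro vector_diff_chain_within h) (auto simp: h_img intro: F)
    then show ?thesis
      using has_vector_derivative_diff[OF y[of l]] l by (fastforce simp: kh o_def)
  qed
  then obtain c where c: "\<And>l. l \<in> {a..} \<Longrightarrow> y l - F (h l) = c"
    using has_vector_derivative_zero_constant[of "{a..}" "\<lambda>l. y l - F (h l)"] by auto
  have eq: "y (k s) = c + F s" if "s \<ge> b" for s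
    using c[of "k s"] k_img hk[OF that] that by (force simp: algebra_simps)
  have "((\<lambda>s. c + F s) has_vector_derivative G (k t)) (at t within {b..})"
    using has_vector_derivative_add[OF has_vector_derivative_const F[OF t]] by simp
  then show ?thesis
    by (rule has_vector_derivative_transform[rotated 2]) (use t eq in auto)
qed

text \<open>The intermediate value theorem makes the image a full half-line, and a continuous
  injection of an interval into the reals has a continuous inverse.\<close>

lemma strict_mono_on_half_line_homeomorphism:
  fixes h :: "real \<Rightarrow> real"
  assumes cont: "continuous_on {a..} h" and mono: "strict_mono_on {a..} h"
    and unb: "\<not> bounded (h ` {a..})"
  shows "homeomorphism {a..} {h a..} h (inv_into {a..} h)"
proof -
  have inj: "inj_on h {a..}"
    by (rule strict_mono_on_imp_inj_on[OF mono])
  have ge: "h a \<le> h l" if "l \<ge> a" for l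
    using strict_mono_on_leD[OF mono, of a l] that by simp
  have img: "h ` {a..} = {h a..}"
  proof (intro subset_antisym subsetI)
    fix t assume t: "t \<in> {h a..}"
    \<comment> \<open>Since \<open>h a\<close> bounds the values from below, unboundedness can only
      be upward.\<close>
    have "\<exists>l\<ge>a. h l > t"
    proof (rule ccontr)
      assume "\<not> ?thesis"
      then have "h ` {a..} \<subseteq> {h a..t}" using ge by force
      with unb show False using bounded_subset[OF bounded_closed_interval] by blast
    qed
    then obtain l where l: "l \<ge> a" "h l > t" by auto
    have "\<exists>s. a \<le> s \<and> s \<le> l \<and> h s = t"
      using l t by (intro IVT' continuous_on_subset[OF cont]) auto
    then show "t \<in> h ` {a..}" by auto
  qed (use ge in auto)
  obtain g where g: "homeomorphism {a..} {h a..} h g"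
    using injective_into_1d_eq_homeomorphism[OF cont] inj img
    by (metis convex_imp_path_connected convex_real_interval(1))
  have "inv_into {a..} h t = g t" if "t \<in> {h a..}" for t
    using g that inj by (intro inv_into_f_eq) (auto simp: homeomorphism_def)
  then show ?thesis
    using homeomorphism_cong[OF g] by simp
qed

theorem lemma1:
  fixes A0 A1 :: "real^'n^'n"
    and \<tau>s :: real
    and \<tau> h :: "real \<Rightarrow> real"
  assumes "\<tau>s > 0"
    and "\<tau> C1_differentiable_on UNIV"
    and "\<And>t. \<tau> t > 0"
    and "\<And>t. t \<ge> 0 \<Longrightarrow> deriv \<tau> t < 1"
    and "C1_within h {-\<tau>s..}"
    and "h ` {-\<tau>s..} \<subseteq> {-\<tau> 0..}"
    and "strict_mono_on {-\<tau>s..} h"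
    and "\<not> bounded (h ` {-\<tau>s..})"
    and "h 0 = 0"
    and "\<And>l. l \<ge> 0 \<Longrightarrow> h l - \<tau> (h l) = h (l - \<tau>s)"
  shows
    "(\<forall>\<zeta> x. continuous_on {-\<tau> 0..0} \<zeta> \<longrightarrow>
        dde_solution (\<tau> 0) \<tau> (\<lambda>_. A0) (\<lambda>_. A1) \<zeta> x \<longrightarrow>
        dde_solution \<tau>s (\<lambda>_. \<tau>s) (\<lambda>l. deriv h l *\<^sub>R A0) (\<lambda>l. deriv h l *\<^sub>R A1)
          (\<lambda>l. \<zeta> (h l)) (\<lambda>l. x (h l))) \<and>
     (\<forall>\<zeta>b xb. continuous_on {-\<tau>s..0} \<zeta>b \<longrightarrow>
        dde_solution \<tau>s (\<lambda>_. \<tau>s) (\<lambda>l. deriv h l *\<^sub>R A0) (\<lambda>l. deriv h l *\<^sub>R A1) \<zeta>b xb \<longrightarrow>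
        dde_solution (\<tau> 0) \<tau> (\<lambda>_. A0) (\<lambda>_. A1)
          (\<lambda>t. \<zeta>b (inv_into {-\<tau>s..} h t)) (\<lambda>t. xb (inv_into {-\<tau>s..} h t)))"
proof -
  let ?k = "inv_into {-\<tau>s..} h"
  obtain h' where h': "\<And>l. l \<ge> -\<tau>s \<Longrightarrow> (h has_vector_derivative h' l) (at l within {-\<tau>s..})"
    using assms(5) unfolding C1_within_def by auto
  have h_cont: "continuous_on {-\<tau>s..} h"
    unfolding continuous_on_eq_continuous_within
    by (auto intro: has_vector_derivative_continuous[OF h'])
  \<comment> \<open>The functional equation at 0 fixes the left end point, so \<open>h\<close> maps
    onto the whole half-line from \<open>-\<tau> 0\<close>.\<close>
  have h_start: "h (-\<tau>s) = -\<tau> 0"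
    using assms(10)[of 0] assms(9) by simp
  have hom: "homeomorphism {-\<tau>s..} {-\<tau> 0..} h ?k"
    using strict_mono_on_half_line_homeomorphism[OF h_cont assms(7,8)] unfolding h_start .
  have kh: "?k (h l) = l" if "l \<ge> -\<tau>s" for l
    using hom that by (auto simp: homeomorphism_def)
  have hk: "h (?k t) = t" and k_ge: "?k t \<ge> -\<tau>s" if "t \<ge> -\<tau> 0" for t
    using hom that by (auto simp: homeomorphism_def)
  have k_cont: "continuous_on {-\<tau> 0..} ?k" and h_img: "h ` {-\<tau>s..} = {-\<tau> 0..}"
    using hom by (auto simp: homeomorphism_def)
  have h_le_iff: "h l \<le> h m \<longleftrightarrow> l \<le> m" if "l \<ge> -\<tau>s" "m \<ge> -\<tau>s" for l m
    using strict_mono_on_less_eq[OF assms(7)] that by simp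
  \<comment> \<open>As \<open>h 0 = 0\<close>, monotonicity preserves signs: initial intervals and
    half-lines of future times correspond under \<open>h\<close>.\<close>
  have h_nonneg: "0 \<le> h l \<longleftrightarrow> 0 \<le> l" and h_nonpos: "h l \<le> 0 \<longleftrightarrow> l \<le> 0" if "l \<ge> -\<tau>s" for l
    using h_le_iff[of 0 l] h_le_iff[of l 0] that assms(1,9) by auto
  have k_nonneg: "0 \<le> ?k t \<longleftrightarrow> 0 \<le> t" and k_nonpos: "?k t \<le> 0 \<longleftrightarrow> t \<le> 0" if "t \<ge> -\<tau> 0" for t
    using h_nonneg[OF k_ge[OF that]] h_nonpos[OF k_ge[OF that]] hk[OF that] by simp_all
  \<comment> \<open>Because \<open>\<tau>s > 0\<close>, every \<open>l \<ge> 0\<close> is interior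
    to the domain of \<open>h\<close>. The derivative within the domain is thus two-sided and equals
    \<open>deriv h l\<close>, even at 0.\<close>
  have dh: "(h has_vector_derivative deriv h l) (at l within {0..})" if "l \<ge> 0" for l
  proof -
    have "l \<in> interior {-\<tau>s..}" using that assms(1) by (simp)
    then have "at l within {-\<tau>s..} = at l" by (rule at_within_interior)
    moreover have "(h has_vector_derivative h' l) (at l within {-\<tau>s..})"
      using that assms(1) by (intro h') linarith
    ultimately have "(h has_vector_derivative h' l) (at l)"
      by simp
    moreover from this have "deriv h l = h' l"
      by (intro DERIV_imp_deriv) (simp add: has_real_derivative_iff_has_vector_derivative)
    ultimately show ?thesis by (simp add: has_vector_derivative_at_within)
  qed
  have h_img0: "h ` {0..} = {0..}"
  proof (intro subset_antisym subsetI)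
    fix t :: real assume "t \<in> {0..}"
    moreover have "t \<ge> -\<tau> 0" using \<open>t \<in> {0..}\<close> assms(3)[of 0] by simp
    ultimately show "t \<in> h ` {0..}" using hk k_nonneg by (intro image_eqI[of _ _ "?k t"]) auto
  qed (use h_nonneg assms(1) in auto)
  \<comment> \<open>The equations are differentiated within \<open>{0..}\<close>, so the
    homeomorphism is restricted to that half-line.\<close>
  have hom0: "homeomorphism {0..} {0..} h ?k"
    by (rule homeomorphism_of_subsets[OF hom _ order_refl]) (use h_img0 assms(1) in auto)
  have scale: "(c *\<^sub>R A0) *v u + (c *\<^sub>R A1) *v v = c *\<^sub>R (A0 *v u + A1 *v v)" for c u v
    by (simp add: scaleR_matrix_vector_assoc scaleR_add_right)

  have part1: "dde_solution \<tau>s (\<lambda>_. \<tau>s) (\<lambda>l. deriv h l *\<^sub>R A0) (\<lambda>l. deriv h l *\<^sub>R A1)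
      (\<lambda>l. \<zeta> (h l)) (\<lambda>l. x (h l))"
    if sol: "dde_solution (\<tau> 0) \<tau> (\<lambda>_. A0) (\<lambda>_. A1) \<zeta> x" for \<zeta> x
    unfolding dde_solution_def
  proof (intro conjI allI impI ballI)
    have "continuous_on {-\<tau> 0..} x" using sol by (simp add: dde_solution_def)
    then show "continuous_on {-\<tau>s..} (\<lambda>l. x (h l))"
      by (rule continuous_on_compose2[OF _ h_cont]) (simp add: h_img)
  next
    fix l :: real assume l: "l \<ge> 0"
    then have "h l \<ge> 0" using h_nonneg assms(1) by simp
    \<comment> \<open>The chain rule needs the outer derivative within the image of
      \<open>{0..}\<close>, which is \<open>{0..}\<close> itself.\<close>
    then have "(x has_vector_derivative A0 *v x (h l) + A1 *v x (h l - \<tau> (h l)))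
        (at (h l) within h ` {0..})"
      using sol by (simp add: dde_solution_def h_img0)
    from vector_diff_chain_within[OF dh[OF l] this]
    show "((\<lambda>l. x (h l)) has_vector_derivative
        (deriv h l *\<^sub>R A0) *v x (h l) + (deriv h l *\<^sub>R A1) *v x (h (l - \<tau>s))) (at l within {0..})"
      by (simp add: scale assms(10)[OF l] o_def)
  next
    fix l assume l: "l \<in> {-\<tau>s..0}"
    then have "h l \<in> {-\<tau> 0..0}" using h_img h_nonpos by force
    then show "x (h l) = \<zeta> (h l)" using sol by (simp add: dde_solution_def)
  qed

  have part2: "dde_solution (\<tau> 0) \<tau> (\<lambda>_. A0) (\<lambda>_. A1) (\<lambda>t. \<zeta>b (?k t)) (\<lambda>t. xb (?k t))"
    if sol: "dde_solution \<tau>s (\<lambda>_. \<tau>s) (\<lambda>l. deriv h l *\<^sub>R A0) (\<lambda>l. deriv h l *\<^sub>R A1) \<zeta>b xb"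
    for \<zeta>b xb
    unfolding dde_solution_def
  proof (intro conjI allI impI ballI)
    have xb_cont: "continuous_on {-\<tau>s..} xb" using sol by (simp add: dde_solution_def)
    then show "continuous_on {-\<tau> 0..} (\<lambda>t. xb (?k t))"
      by (rule continuous_on_compose2[OF _ k_cont]) (use k_ge in auto)
    fix t :: real assume t: "t \<ge> 0"
    define G where "G l = A0 *v xb l + A1 *v xb (l - \<tau>s)" for l
    have "continuous_on {0..} xb"
      by (rule continuous_on_subset[OF xb_cont]) (use assms(1) in auto)
    moreover have "continuous_on {0..} (\<lambda>l. xb (l - \<tau>s))"
      by (rule continuous_on_compose2[OF xb_cont]) (auto intro!: continuous_intros)
    ultimately have G_cont: "continuous_on {0..} G"
      unfolding G_def
      by (intro continuous_on_add bounded_linear.continuous_on[OF matrix_vector_mul_bounded_linear])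
    \<comment> \<open>Here \<open>G\<close> is the right-hand side of (B) without the factor
      \<open>deriv h l\<close>; the substitution lemma applies with both end points 0.\<close>
    have "((\<lambda>t. xb (?k t)) has_vector_derivative G (?k t)) (at t within {0..})"
    proof (rule has_vector_derivative_compose_inverse[OF _ dh hom0 G_cont t])
      show "(xb has_vector_derivative deriv h l *\<^sub>R G l) (at l within {0..})" if "l \<ge> 0" for l
        using sol that by (simp add: dde_solution_def scale G_def)
    qed
    \<comment> \<open>The functional equation at \<open>?k t\<close> reads
      \<open>t - \<tau> t = h (?k t - \<tau>s)\<close>. Since \<open>?k t \<ge> 0\<close>, the
      argument of \<open>h\<close> lies in its domain and \<open>?k\<close> undoes
      \<open>h\<close>.\<close>
    moreover have "?k (t - \<tau> t) = ?k t - \<tau>s"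
    proof -
      have "t \<ge> -\<tau> 0" using t assms(3)[of 0] by simp
      then have "?k t \<ge> 0" "h (?k t) = t" using t k_nonneg hk by auto
      then show ?thesis using assms(10)[of "?k t"] kh[of "?k t - \<tau>s"] by simp
    qed
    ultimately show "((\<lambda>t. xb (?k t)) has_vector_derivative
        A0 *v xb (?k t) + A1 *v xb (?k (t - \<tau> t))) (at t within {0..})"
      by (simp add: G_def)
  next
    fix t assume t: "t \<in> {-\<tau> 0..0}"
    then have "?k t \<in> {-\<tau>s..0}" using k_ge k_nonpos by simp
    then show "xb (?k t) = \<zeta>b (?k t)" using sol by (simp add: dde_solution_def)
  qed
  show ?thesis using part1 part2 by blast
qed

end
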